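(* For every $n\ge 1$, there is an exact affine OBDD with the identity variable order $(1,\dots,n)$, having $p(n)$ classical states and $n$ affine states, that computes the weighted sum function $\mathtt{WS}_n$.
   Context: $p(n)$ is the smallest prime greater than $n$. For $x\in\{0,1\}^n$ let $s_n(x)=\left(\sum_{i=1}^n i\cdot x_i\right)\bmod p(n)$. Then $\mathtt{WS}_n(x)=x_{s_n(x)}$ if $s_n(x)\in\{1,\dots,n\}$ and $\mathtt{WS}_n(x)=0$ otherwise. An affine OBDD (AfOBDD) is a tuple $(S,E,\delta,T,s_I,v_0,S_a,E_a,\pi)$: $S$ is a finite set of classical states with initial state $s_I$ and accepting set $S_a\subseteq S$; $E=\{e_1,\dots,e_{m_2}\}$ is a set of affine states with accepting set $E_a\subseteq E$; $v_0\in\mathbb{R}^{m_2}$ is an initial affine state (a real vector whose entries sum to $1$); $\pi$ is a permutation of the variable indices; for each step $i$, $\delta_i:S\times\{0,1\}\to S$; and for each step $i$, classical state $s$ and bit $b$ there is a real $m_2\times m_2$ matrix $T_i^{s,b}$ each of whose columns sums to $1$. On input $x$ it starts in $(s_I,v_0)$; at step $j$, from $(s,v_{j-1})$ it sets $v_j=T_j^{s,x_{\pi(j)}}v_{j-1}$ and then the classical state to $\delta_j(s,x_{\pi(j)})$. If the final classical state is not in $S_a$ the input is rejected; otherwise it is accepted with probability $\sum_{e_i\in E_a}|v_f[i]|/\|v_f\|_1$, $v_f$ the final affine state. It computes $f$ exactly if inputs with $f(x)=1$ are accepted with probability $1$ and inputs with $f(x)=0$ with probability $0$. *)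

theory Defs
  imports
    "Jordan_Normal_Form.Matrix"
    "HOL-Combinatorics.Permutations"
    "HOL-Computational_Algebra.Primes"
    "HOL-Library.FuncSet"
begin

definition next_prime :: "nat \<Rightarrow> nat" where
  "next_prime n = (LEAST p. prime p \<and> n < p)"

definition cube :: "nat \<Rightarrow> (nat \<Rightarrow> nat) set" where
  "cube n = {1..n} \<rightarrow>\<^sub>E {0, 1}"

definition ws_index :: "nat \<Rightarrow> (nat \<Rightarrow> nat) \<Rightarrow> nat" where
  "ws_index n x = (\<Sum>i = 1..n. i * x i) mod next_prime n"

definition WS :: "nat \<Rightarrow> (nat \<Rightarrow> nat) \<Rightarrow> nat" where
  "WS n x = (if ws_index n x \<in> {1..n} then x (ws_index n x) else 0)"

text \<open>
  The set of affine states \<open>{e\<^sub>1, \<dots>, e\<^sub>m}\<close> is represented by its cardinality \<open>m\<close>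
  (field \<open>num_affine\<close>); following the indexing of vectors and matrices in the library,
  the affine state \<open>e\<^sub>i\<close> is the index \<open>i - 1\<close> in \<open>{..<m}\<close>. Steps and input variables
  are numbered from \<open>1\<close>.
\<close>

record 's afobdd =
  classical_states :: "'s set"
  num_affine :: nat
  c_step :: "nat \<Rightarrow> 's \<Rightarrow> nat \<Rightarrow> 's"
  a_step :: "nat \<Rightarrow> 's \<Rightarrow> nat \<Rightarrow> real mat"
  init_classical :: 's
  init_affine :: "real vec"
  acc_classical :: "'s set"
  acc_affine :: "nat set"
  var_order :: "nat \<Rightarrow> nat"

definition affine_vec :: "nat \<Rightarrow> real vec \<Rightarrow> bool" where
  "affine_vec m v \<longleftrightarrow> v \<in> carrier_vec m \<and> (\<Sum>i<m. v $ i) = 1"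

definition affine_mat :: "nat \<Rightarrow> real mat \<Rightarrow> bool" where
  "affine_mat m A \<longleftrightarrow> A \<in> carrier_mat m m \<and> (\<forall>j<m. (\<Sum>i<m. A $$ (i, j)) = 1)"

definition is_afobdd :: "nat \<Rightarrow> 's afobdd \<Rightarrow> bool" where
  "is_afobdd n M \<longleftrightarrow>
     finite (classical_states M) \<and>
     init_classical M \<in> classical_states M \<and>
     acc_classical M \<subseteq> classical_states M \<and>
     acc_affine M \<subseteq> {..<num_affine M} \<and>
     affine_vec (num_affine M) (init_affine M) \<and>
     var_order M permutes {1..n} \<and>
     (\<forall>i \<in> {1..n}. \<forall>s \<in> classical_states M. \<forall>b \<in> {0, 1}.
        c_step M i s b \<in> classical_states M \<and>
        affine_mat (num_affine M) (a_step M i s b))"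

primrec run :: "'s afobdd \<Rightarrow> (nat \<Rightarrow> nat) \<Rightarrow> nat \<Rightarrow> 's \<times> real vec" where
  "run M x 0 = (init_classical M, init_affine M)"
| "run M x (Suc j) =
     (let (s, v) = run M x j; b = x (var_order M (Suc j))
      in (c_step M (Suc j) s b, a_step M (Suc j) s b *\<^sub>v v))"

definition accept_prob :: "nat \<Rightarrow> 's afobdd \<Rightarrow> (nat \<Rightarrow> nat) \<Rightarrow> real" where
  "accept_prob n M x =
     (let (s, v) = run M x n
      in if s \<in> acc_classical M
         then (\<Sum>i \<in> acc_affine M. \<bar>v $ i\<bar>) / (\<Sum>i<num_affine M. \<bar>v $ i\<bar>)
         else 0)"

definition computes_exactly ::
  "nat \<Rightarrow> 's afobdd \<Rightarrow> ((nat \<Rightarrow> nat) \<Rightarrow> nat) \<Rightarrow> bool" where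
  "computes_exactly n M f \<longleftrightarrow>
     (\<forall>x \<in> cube n. (f x = 1 \<longrightarrow> accept_prob n M x = 1) \<and>
                    (f x = 0 \<longrightarrow> accept_prob n M x = 0))"

end

theory Submission
  imports Defs
begin

text \<open>
  The classical state carries the partial weighted sum modulo \<open>p(n)\<close>. Before the last step the
  affine state is \<open>(1 - \<Sum>x\<^sub>i, x\<^sub>1, \<dots>, x\<^sub>n\<^sub>-\<^sub>1)\<close>, so the bits are kept in all coordinates but the
  first, which absorbs the normalisation; as the coordinates always sum to \<open>1\<close>, adding a constant
  vector of sum \<open>0\<close> is linear. The matrix of the last step may depend on the classical state and on \<open>x\<^sub>n\<close>,
  hence on the final index \<open>t\<close>, and it maps the affine state to the basis vector
  selected by \<open>x\<^sub>t\<close>.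
\<close>

lemma next_prime_gt: "n < next_prime n"
  unfolding next_prime_def using LeastI_ex[OF bigger_prime[of n]] by blast

text \<open>The identity with \<open>b\<close> times \<open>unit_vec n j - unit_vec n 0\<close>
  added to every column: on vectors of sum 1 it acts as a translation.\<close>

definition ws_store_mat :: "nat \<Rightarrow> nat \<Rightarrow> nat \<Rightarrow> real mat" where
  "ws_store_mat n j b =
     mat n n (\<lambda>(i, k). of_bool (i = k) + real b * (of_bool (i = j) - of_bool (i = 0)))"

text \<open>
  For \<open>t = 0\<close> the selected coordinate is meaningless; these inputs are rejected classically.
\<close>

definition ws_select_mat :: "nat \<Rightarrow> nat \<Rightarrow> nat \<Rightarrow> real mat" where
  "ws_select_mat n t b =
     mat n n (\<lambda>(i, k). of_bool (i = 0) +
       (if t = n then real b else of_bool (k = t)) * (of_bool (i = n - 1) - of_bool (i = 0)))"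

text \<open>
  For \<open>n = 1\<close> the rejecting basis vector \<open>0\<close> and the accepting one \<open>n - 1\<close> coincide; there the
  accepting classical states alone decide, since \<open>t = 1\<close> forces \<open>x\<^sub>1 = 1\<close>.
\<close>

definition ws_obdd :: "nat \<Rightarrow> nat afobdd" where
  "ws_obdd n = \<lparr>
     classical_states = {..<next_prime n},
     num_affine = n,
     c_step = (\<lambda>j s b. (s + j * b) mod next_prime n),
     a_step = (\<lambda>j s b. if j < n then ws_store_mat n j b
                       else ws_select_mat n ((s + j * b) mod next_prime n) b),
     init_classical = 0,
     init_affine = unit_vec n 0,
     acc_classical = {1..n},
     acc_affine = {n - 1},
     var_order = id\<rparr>"

definition ws_memory :: "nat \<Rightarrow> (nat \<Rightarrow> nat) \<Rightarrow> nat \<Rightarrow> real vec" where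
  "ws_memory n x j =
     vec n (\<lambda>i. if i = 0 then 1 - (\<Sum>k = 1..j. real (x k)) else if i \<le> j then real (x i) else 0)"

lemma sum_lessThan_of_bool: "j < n \<Longrightarrow> (\<Sum>i<n. of_bool (i = j)) = (1 :: real)" for j n :: nat
  by (simp add: of_bool_def)

lemma affine_mat_ws_store_mat:
  assumes "j < n"
  shows "affine_mat n (ws_store_mat n j b)"
  using assms
  by (auto simp: affine_mat_def ws_store_mat_def sum.distrib sum_subtractf sum_lessThan_of_bool
      simp flip: sum_distrib_left)

lemma affine_mat_ws_select_mat:
  assumes "0 < n"
  shows "affine_mat n (ws_select_mat n t b)"
  using assms
  by (auto simp: affine_mat_def ws_select_mat_def sum.distrib sum_subtractf sum_lessThan_of_bool
      simp flip: sum_distrib_left)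

lemma is_afobdd_ws_obdd:
  assumes "n \<ge> 1"
  shows "is_afobdd n (ws_obdd n)"
  \<comment> \<open>This bound puts all of \<open>{1..n}\<close> among the residues.\<close>
  using assms next_prime_gt[of n]
  by (auto simp: is_afobdd_def ws_obdd_def affine_vec_def permutes_id unit_vec_def
      affine_mat_ws_store_mat affine_mat_ws_select_mat)

text \<open>The bits subtracted in coordinate 0 reappear in coordinates 1 to \<open>j\<close>, which
  exist because \<open>j < n\<close>.\<close>

lemma ws_memory_affine:
  assumes "j < n"
  shows "(\<Sum>i<n. ws_memory n x j $ i) = 1"
proof -
  have "(\<Sum>i<n. ws_memory n x j $ i) = ws_memory n x j $ 0 + (\<Sum>i\<in>{1..<n}. ws_memory n x j $ i)"
    using assms by (simp add: lessThan_atLeast0 sum.atLeast_Suc_lessThan)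
  also have "(\<Sum>i\<in>{1..<n}. ws_memory n x j $ i) = (\<Sum>i = 1..j. real (x i))"
    using assms by (intro sum.mono_neutral_cong_right) (auto simp: ws_memory_def)
  finally show ?thesis
    using assms by (simp add: ws_memory_def)
qed

lemma ws_store_mat_mult:
  assumes v: "v \<in> carrier_vec n" "(\<Sum>k<n. v $ k) = 1" and i: "i < n"
  shows "(ws_store_mat n j b *\<^sub>v v) $ i = v $ i + real b * (of_bool (i = j) - of_bool (i = 0))"
proof -
  let ?d = "real b * (of_bool (i = j) - of_bool (i = 0))"
  have "(ws_store_mat n j b *\<^sub>v v) $ i = (\<Sum>k<n. (of_bool (i = k) + ?d) * v $ k)"
    using v(1) i by (simp add: ws_store_mat_def scalar_prod_def lessThan_atLeast0)
  also have "\<dots> = (\<Sum>k<n. of_bool (i = k) * v $ k) + ?d * (\<Sum>k<n. v $ k)"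
    by (simp only: distrib_right sum.distrib sum_distrib_left)
  also have "(\<Sum>k<n. of_bool (i = k) * v $ k) = v $ i"
    using i by (simp add: of_bool_def if_distrib[of "\<lambda>c. c * _"] cong: if_cong)
  finally show ?thesis
    by (simp add: v(2))
qed

text \<open>For \<open>t < n\<close> the column factor picks out \<open>v $ t\<close>. There is no
  coordinate \<open>n\<close>, so for \<open>t = n\<close> the factor is the constant
  \<open>b\<close>, which survives because \<open>v\<close> has sum 1.\<close>

lemma ws_select_mat_mult:
  assumes v: "v \<in> carrier_vec n" "(\<Sum>k<n. v $ k) = 1" and i: "i < n" and t: "t \<le> n"
  shows "(ws_select_mat n t b *\<^sub>v v) $ i =
    of_bool (i = 0) + (if t = n then real b else v $ t) * (of_bool (i = n - 1) - of_bool (i = 0))"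
proof -
  let ?d = "of_bool (i = n - 1) - of_bool (i = 0) :: real"
  let ?r = "\<lambda>k. if t = n then real b else of_bool (k = t)"
  have "(ws_select_mat n t b *\<^sub>v v) $ i = (\<Sum>k<n. (of_bool (i = 0) + ?r k * ?d) * v $ k)"
    using v(1) i by (simp add: ws_select_mat_def scalar_prod_def lessThan_atLeast0)
  also have "\<dots> = of_bool (i = 0) * (\<Sum>k<n. v $ k) + ?d * (\<Sum>k<n. ?r k * v $ k)"
    by (simp only: distrib_right sum.distrib sum_distrib_left) (simp only: ac_simps)
  also have "(\<Sum>k<n. ?r k * v $ k) = (if t = n then real b else v $ t)"
    using t v(2)
    by (auto simp: of_bool_def if_distrib[of "\<lambda>c. c * _"] simp flip: sum_distrib_left cong: if_cong)
  finally show ?thesis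
    by (simp add: v(2))
qed

lemma run_ws_obdd:
  "j < n \<Longrightarrow> run (ws_obdd n) x j = ((\<Sum>i = 1..j. i * x i) mod next_prime n, ws_memory n x j)"
proof (induction j)
  case 0
  then show ?case
    by (auto simp: ws_obdd_def ws_memory_def)
next
  case (Suc j)
  have "ws_store_mat n (Suc j) (x (Suc j)) *\<^sub>v ws_memory n x j = ws_memory n x (Suc j)"
    (is "?A *\<^sub>v ?v = ?w")
  proof (rule eq_vecI)
    fix i assume "i < dim_vec ?w"
    then have i: "i < n" by (simp add: ws_memory_def)
    have "?v \<in> carrier_vec n" by (simp add: ws_memory_def)
    \<comment> \<open>Coordinate \<open>Suc j\<close> of \<open>?v\<close> is still 0, so adding the
      new bit there stores it.\<close>
    from ws_store_mat_mult[OF this ws_memory_affine i] Suc.prems i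
    show "(?A *\<^sub>v ?v) $ i = ?w $ i"
      by (auto simp: ws_memory_def le_Suc_eq)
  qed (simp add: ws_memory_def ws_store_mat_def)
  with Suc show ?case
    by (simp add: ws_obdd_def Let_def mod_simps)
qed

lemma accept_prob_ws_obdd:
  assumes n: "n \<ge> 1" and x: "x \<in> cube n"
  shows "accept_prob n (ws_obdd n) x = real (WS n x)"
proof -
  define t where "t = ws_index n x"
  define w where "w = ws_select_mat n t (x n) *\<^sub>v ws_memory n x (n - 1)"
  obtain m where m: "n = Suc m" using n by (cases n) auto
  have "run (ws_obdd n) x n = (t, w)"
    using run_ws_obdd[of m n x]
    by (simp add: m t_def w_def ws_index_def ws_obdd_def Let_def mod_simps add.commute)
  then have acc: "accept_prob n (ws_obdd n) x =
      (if t \<in> {1..n} then \<bar>w $ (n - 1)\<bar> / (\<Sum>i<n. \<bar>w $ i\<bar>) else 0)"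
    by (simp add: accept_prob_def ws_obdd_def)
  show ?thesis
  proof (cases "t \<in> {1..n}")
    case True
    have w: "w $ i = of_bool (i = 0) + real (x t) * (of_bool (i = n - 1) - of_bool (i = 0))"
      if "i < n" for i
    proof -
      have "ws_memory n x m \<in> carrier_vec n" by (simp add: ws_memory_def)
      \<comment> \<open>For \<open>t < n\<close> the memory holds \<open>x t\<close> in coordinate
        \<open>t\<close>, as \<open>t \<noteq> 0\<close>; for \<open>t = n\<close> the bit is the
        one just read.\<close>
      from ws_select_mat_mult[OF this ws_memory_affine that, of t "x n"] True
      show ?thesis
        by (auto simp: m w_def ws_memory_def)
    qed
    have xt: "x t = 0 \<or> x t = 1"
      using x True by (auto simp: cube_def PiE_iff)
    have WS: "WS n x = x t"
      using True by (simp add: WS_def t_def)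
    show ?thesis
    proof (cases "x t = 1")
      case one: True
      then have "\<bar>w $ i\<bar> = of_bool (i = n - 1)" if "i < n" for i
        using w[OF that] by simp
      with n True one show ?thesis
        by (simp add: acc WS sum_lessThan_of_bool)
    next
      case False
      with xt have zero: "x t = 0" by simp
      \<comment> \<open>Here \<open>w\<close> is the basis vector \<open>0\<close>, which is
        rejecting only if \<open>n - 1 \<noteq> 0\<close>.\<close>
      have "n \<noteq> 1"
      proof
        assume "n = 1"
        with zero True have "t = 0" by (simp add: t_def ws_index_def)
        with True show False by simp
      qed
      with n w[of "n - 1"] zero show ?thesis
        by (simp add: acc WS)
    qed
  qed (auto simp: acc WS_def simp flip: t_def)
qed

theorem theorem3:
  fixes n :: nat
  assumes "n \<ge> 1"
  shows "\<exists>M :: nat afobdd.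
           is_afobdd n M \<and>
           var_order M = id \<and>
           card (classical_states M) = next_prime n \<and>
           num_affine M = n \<and>
           computes_exactly n M (WS n)"
proof (intro exI conjI)
  show "is_afobdd n (ws_obdd n)"
    using assms by (rule is_afobdd_ws_obdd)
  show "computes_exactly n (ws_obdd n) (WS n)"
    using assms by (simp add: computes_exactly_def accept_prob_ws_obdd)
qed (simp_all add: ws_obdd_def)

end
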